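(* Let $m\ge 1$ be an integer and let $n$ be a prime such that $m\mid (n-1)$; put $d=2m$ and $N=2n$. Let $g$ be a primitive root modulo $n$ and let $$\Lambda=\{k_1,\dots,k_m\}=\big\{g^0,\,g^{\frac{n-1}{m}},\,g^{\frac{2(n-1)}{m}},\dots,g^{\frac{(m-1)(n-1)}{m}}\big\}\bmod n \subset\{1,\dots,n-1\}.$$ Let $F_\Lambda\in\mathbb{C}^{m\times n}$ be the matrix with entries $(F_\Lambda)_{s,j}=e^{2\pi \mathrm{i} k_s j/n}$ for $1\le s\le m$, $1\le j\le n$, and let $$\boldsymbol{V}=\frac{1}{\sqrt m}\begin{bmatrix}\operatorname{Re}F_\Lambda & -\operatorname{Im}F_\Lambda\\ \operatorname{Im}F_\Lambda & \operatorname{Re}F_\Lambda\end{bmatrix}\in\mathbb{R}^{d\times N},$$ with columns $\boldsymbol{v}_1,\dots,\boldsymbol{v}_N$. Let $\mu(\boldsymbol{V}):=\max_{i\neq j}|\boldsymbol{v}_i^\top\boldsymbol{v}_j|$ be the mutual coherence of $\boldsymbol{V}$. Then $$\mu(\boldsymbol{V})\le\frac{\sqrt n}{m}.$$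
   Context: Here $\mathrm{i}=\sqrt{-1}$, and $\operatorname{Re}$, $\operatorname{Im}$ are taken entrywise. *)

theory Defs
  imports
    Complex_Main
    "HOL-Number_Theory.Residue_Primitive_Roots"
    "Jordan_Normal_Form.Matrix"
begin

definition power_residue_set :: "nat \<Rightarrow> nat \<Rightarrow> nat \<Rightarrow> nat set" where
  "power_residue_set m n g = {g ^ (t * (n - 1) div m) mod n | t. t < m}"

(* Matrices are indexed from 0, so the (s, j) entry below is the (s + 1, j + 1) entry in
   1-based notation; the frequencies k 1, ..., k m keep their 1-based numbering. *)
definition partial_Fourier_mat :: "nat \<Rightarrow> nat \<Rightarrow> (nat \<Rightarrow> nat) \<Rightarrow> complex mat" where
  "partial_Fourier_mat m n k =
     mat m n (\<lambda>(s, j). exp (2 * of_real pi * \<i> * of_nat (k (s + 1)) * of_nat (j + 1) / of_nat n))"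

definition real_frame_mat :: "nat \<Rightarrow> complex mat \<Rightarrow> real mat" where
  "real_frame_mat m F =
     (1 / sqrt (real m)) \<cdot>\<^sub>m
       four_block_mat (map_mat Re F) (- map_mat Im F)
                      (map_mat Im F) (map_mat Re F)"

lemma partial_Fourier_mat_carrier: "partial_Fourier_mat m n k \<in> carrier_mat m n"
  by (simp add: partial_Fourier_mat_def)

lemma real_frame_mat_carrier:
  "F \<in> carrier_mat m n \<Longrightarrow> real_frame_mat m F \<in> carrier_mat (2 * m) (2 * n)"
  by (auto simp: real_frame_mat_def)

(* Max is only meaningful for matrices with at least two columns. *)
definition mutual_coherence :: "real mat \<Rightarrow> real" where
  "mutual_coherence V =
     Max {\<bar>col V i \<bullet> col V j\<bar> | i j. i < dim_col V \<and> j < dim_col V \<and> i \<noteq> j}"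

end

theory Submission
  imports Defs "HOL-Analysis.Complex_Transcendental"
begin

text \<open>
  Identify the real vector with upper half \<open>Re z\<close> and lower half \<open>Im z\<close> with the complex
  vector \<open>z\<close>. Then column \<open>n + j\<close> of the frame is \<open>\<i>\<close> times column \<open>j\<close>, and the
  inner products are, up to a unit and a factor \<open>1/m\<close>, real parts of the Gaussian periods
  \<open>S(l) = (\<Sum>h\<in>H. exp (2\<pi>\<i>hl/n))\<close> over the subgroup \<open>H\<close> of \<open>m\<close>-th roots of unity modulo \<open>n\<close>.
  By Parseval, \<open>\<bar>S(l)\<bar>\<^sup>2\<close> summed over all residues \<open>l\<close> gives \<open>n * card H\<close>.
  As \<open>S\<close> is constant on the coset \<open>lH\<close>, which has \<open>card H\<close> elements
  when \<open>l\<close> is a unit, \<open>\<bar>S(l)\<bar>\<^sup>2 \<le> n\<close>.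
\<close>

section \<open>Additive characters modulo \<open>n\<close>, with integer arguments so that
  differences make sense\<close>

definition unit_char :: "nat \<Rightarrow> int \<Rightarrow> complex" where
  "unit_char n x = cis (2 * pi * of_int x / of_nat n)"

lemma unit_char_0 [simp]: "unit_char n 0 = 1"
  by (simp add: unit_char_def)

lemma norm_unit_char [simp]: "cmod (unit_char n x) = 1"
  by (simp add: unit_char_def)

lemma unit_char_add: "unit_char n (x + y) = unit_char n x * unit_char n y"
  by (simp add: unit_char_def cis_mult ring_distribs add_divide_distrib)

lemma unit_char_diff: "unit_char n (x - y) = unit_char n x * cnj (unit_char n y)"
  by (simp add: unit_char_def cis_mult cis_cnj ring_distribs diff_divide_distrib)

lemma unit_char_power: "unit_char n (x * int l) = unit_char n x ^ l"
  by (induction l) (simp_all add: unit_char_add ring_distribs)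

lemma unit_char_eq_1_iff:
  assumes "n > 0"
  shows "unit_char n x = 1 \<longleftrightarrow> int n dvd x"
proof -
  have "unit_char n x = exp (\<i> * of_real (2 * pi * of_int x / of_nat n))"
    by (simp add: unit_char_def cis_conv_exp)
  then have "unit_char n x = 1 \<longleftrightarrow> (\<exists>j::int. 2 * pi * of_int x / of_nat n = of_int (2 * j) * pi)"
    by (simp add: exp_eq_1)
  also have "\<dots> \<longleftrightarrow> (\<exists>j::int. real_of_int x = of_int (int n * j))"
    using assms by (intro ex_cong1) (auto simp: field_simps)
  also have "\<dots> \<longleftrightarrow> int n dvd x"
    unfolding of_int_eq_iff by (auto simp: dvd_def)
  finally show ?thesis .
qed

lemma unit_char_cong:
  assumes "[x = y] (mod int n)"
  shows "unit_char n x = unit_char n y"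
proof (cases "n > 0")
  case True
  have "unit_char n (x - y) = 1"
    using assms True by (simp add: unit_char_eq_1_iff cong_iff_dvd_diff)
  then show ?thesis
    using unit_char_add[of n "x - y" y] by simp
qed (simp add: unit_char_def)

text \<open>A geometric sum whose ratio \<open>unit_char n x\<close> is an \<open>n\<close>-th root
  of unity: it vanishes unless the ratio is 1. This is the orthogonality behind Parseval.\<close>

lemma sum_unit_char:
  assumes "n > 0"
  shows "(\<Sum>l<n. unit_char n (x * int l)) = (if int n dvd x then of_nat n else 0)"
proof (cases "int n dvd x")
  case True
  then have "unit_char n x = 1"
    using assms by (simp add: unit_char_eq_1_iff)
  then show ?thesis
    using True by (simp add: unit_char_power)
next
  case False
  have "unit_char n x ^ n = 1"
    using unit_char_power[of n x n] unit_char_eq_1_iff[OF assms, of "x * int n"] by simp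
  then show ?thesis
    using False assms by (simp add: unit_char_power geometric_sum unit_char_eq_1_iff)
qed

section \<open>Character sums over a set of residues, and their bound by Parseval\<close>

definition char_sum :: "nat \<Rightarrow> nat set \<Rightarrow> int \<Rightarrow> complex" where
  "char_sum n H l = (\<Sum>h\<in>H. unit_char n (int h * l))"

lemma char_sum_cong:
  assumes "[l = l'] (mod int n)"
  shows "char_sum n H l = char_sum n H l'"
  unfolding char_sum_def
  by (intro sum.cong refl unit_char_cong cong_mult assms cong_refl)

text \<open>Expanding the square and summing over \<open>l\<close> first leaves only the diagonal
  \<open>h = h'\<close>, because distinct elements of \<open>H\<close>, being less than
  \<open>n\<close>, are incongruent modulo \<open>n\<close>.\<close>

lemma parseval_char_sum:
  assumes "H \<subseteq> {..<n}"
  shows "(\<Sum>l<n. (cmod (char_sum n H (int l)))\<^sup>2) = real n * real (card H)"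
proof (cases "n > 0")
  case True
  have fin: "finite H"
    using assms finite_subset by blast
  have orth: "(\<Sum>l<n. unit_char n ((int h - int h') * int l)) = (if h = h' then of_nat n else 0)"
    if "h \<in> H" "h' \<in> H" for h h'
  proof -
    have "int n dvd int h - int h' \<longleftrightarrow> h = h'"
      using that assms True
      by (auto simp: cong_iff_dvd_diff[symmetric] cong_int_iff
          dest: cong_less_modulus_unique_nat)
    then show ?thesis
      using sum_unit_char[OF True] by simp
  qed
  have "complex_of_real (\<Sum>l<n. (cmod (char_sum n H (int l)))\<^sup>2)
      = (\<Sum>l<n. \<Sum>h\<in>H. \<Sum>h'\<in>H. unit_char n ((int h - int h') * int l))"
    by (simp add: complex_norm_square char_sum_def sum_product unit_char_diff left_diff_distrib
        cnj_sum del: of_real_power)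
  also have "\<dots> = (\<Sum>h\<in>H. \<Sum>h'\<in>H. \<Sum>l<n. unit_char n ((int h - int h') * int l))"
    by (subst sum.swap) (simp add: sum.swap[of _ "{..<n}"])
  also have "\<dots> = (\<Sum>h\<in>H. \<Sum>h'\<in>H. if h = h' then of_nat n else 0)"
    by (intro sum.cong refl orth)
  also have "\<dots> = complex_of_real (real n * real (card H))"
    using fin by simp
  finally show ?thesis
    by (simp only: of_real_eq_iff)
qed (use assms in simp)

lemma inj_on_mult_mod:
  fixes n a :: nat
  assumes "coprime a n" "H \<subseteq> {..<n}"
  shows "inj_on (\<lambda>h. a * h mod n) H"
proof (rule inj_onI)
  fix x y assume "x \<in> H" "y \<in> H" "a * x mod n = a * y mod n"
  then have "[x = y] (mod n)"
    using assms(1) by (metis cong_def cong_mult_lcancel_nat)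
  then show "x = y"
    using \<open>x \<in> H\<close> \<open>y \<in> H\<close> assms(2) by (auto dest: cong_less_modulus_unique_nat)
qed

lemma cmod_char_sum_le:
  fixes l :: int
  assumes H: "H \<subseteq> {..<n}" "H \<noteq> {}"
    and coprime_H: "\<And>h. h \<in> H \<Longrightarrow> coprime h n"
    and closed: "\<And>h h'. h \<in> H \<Longrightarrow> h' \<in> H \<Longrightarrow> h * h' mod n \<in> H"
    and l: "coprime l (int n)"
  shows "cmod (char_sum n H l) \<le> sqrt (real n)"
proof -
  have fin: "finite H"
    using H finite_subset by blast
  then have card_pos: "card H > 0"
    using H by (simp add: card_gt_0_iff)
  have "n > 0"
    using H by fastforce
  have inv: "char_sum n H (int a * j) = char_sum n H j" if "a \<in> H" for a j
  proof -
    have inj: "inj_on (\<lambda>h. a * h mod n) H"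
      using inj_on_mult_mod[OF coprime_H[OF that] H(1)] .
    \<comment> \<open>Multiplication by \<open>a\<close> maps the finite set \<open>H\<close>
      injectively into itself, so it permutes \<open>H\<close>. This is where closure
      enters.\<close>
    have img: "(\<lambda>h. a * h mod n) ` H = H"
      using fin inj closed that by (intro endo_inj_surj) auto
    have "char_sum n H j = (\<Sum>h\<in>(\<lambda>h. a * h mod n) ` H. unit_char n (int h * j))"
      unfolding img char_sum_def ..
    also have "\<dots> = (\<Sum>h\<in>H. unit_char n (int (a * h mod n) * j))"
      by (simp add: sum.reindex[OF inj])
    also have "\<dots> = (\<Sum>h\<in>H. unit_char n (int h * (int a * j)))"
    proof (intro sum.cong refl unit_char_cong)
      fix h
      show "[int (a * h mod n) * j = int h * (int a * j)] (mod int n)"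
        by (simp add: cong_def zmod_int mod_simps mult_ac)
    qed
    finally show ?thesis
      by (simp add: char_sum_def)
  qed
  \<comment> \<open>A representative of \<open>l\<close> in \<open>{0..<n}\<close>: the coset of
    \<open>l\<close> then consists of natural indices \<open>b * h mod n\<close> that occur in the
    Parseval sum.\<close>
  define b where "b = nat (l mod int n)"
  have b: "int b = l mod int n"
    using \<open>n > 0\<close> by (simp add: b_def)
  have "coprime (int b) (int n)"
    using l \<open>n > 0\<close> by (simp add: b coprime_mod_left_iff)
  then have "coprime b n"
    by simp
  then have inj: "inj_on (\<lambda>h. b * h mod n) H"
    using inj_on_mult_mod H(1) by blast
  have const: "char_sum n H (int (b * h mod n)) = char_sum n H l" if "h \<in> H" for h
  proof -
    have "[int (b * h mod n) = int h * l] (mod int n)"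
      by (simp add: cong_def zmod_int b mod_simps mult_ac)
    then show ?thesis
      using char_sum_cong inv[OF that] by metis
  qed
  have "real (card H) * (cmod (char_sum n H l))\<^sup>2
      = (\<Sum>h\<in>H. (cmod (char_sum n H (int (b * h mod n))))\<^sup>2)"
    by (simp add: const)
  also have "\<dots> = (\<Sum>j\<in>(\<lambda>h. b * h mod n) ` H. (cmod (char_sum n H (int j)))\<^sup>2)"
    by (simp add: sum.reindex[OF inj])
  \<comment> \<open>The coset contributes \<open>card H\<close> equal terms to the Parseval sum; the
    terms off the coset are nonnegative and can be added.\<close>
  also have "\<dots> \<le> (\<Sum>j<n. (cmod (char_sum n H (int j)))\<^sup>2)"
    using \<open>n > 0\<close> by (intro sum_mono2) auto
  also have "\<dots> = real (card H) * real n"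
    using parseval_char_sum[OF H(1)] by simp
  finally have "(cmod (char_sum n H l))\<^sup>2 \<le> real n"
    using card_pos by simp
  then show ?thesis
    by (rule real_le_rsqrt)
qed

section \<open>The subgroup of order \<open>m\<close> generated by a power of the primitive
  root\<close>

context
  fixes m n g :: nat
  assumes m_pos: "m \<ge> 1"
    and prime_n: "prime n"
    and m_dvd: "m dvd (n - 1)"
    and primroot: "residue_primroot n g"
begin

text \<open>The exponent in the definition parses as \<open>(t * (n - 1)) div m\<close>; since
  \<open>m\<close> divides \<open>n - 1\<close>, the quotient can be formed before multiplying by
  \<open>t\<close>.\<close>

lemma power_residue_set_eq:
  "power_residue_set m n g = (\<lambda>t. g ^ (t * ((n - 1) div m)) mod n) ` {..<m}"
  using m_dvd by (auto simp: power_residue_set_def div_mult_swap image_iff)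

text \<open>With \<open>q = (n - 1) div m\<close>, the order of \<open>g\<close> is
  \<open>n - 1 = m * q\<close>, so congruence of the exponents modulo \<open>m * q\<close> cancels
  \<open>q\<close>. In other words, \<open>g ^ q\<close> has order \<open>m\<close>.\<close>

lemma power_residue_exponent_cong:
  "[g ^ (t * ((n - 1) div m)) = g ^ (t' * ((n - 1) div m))] (mod n) \<longleftrightarrow> [t = t'] (mod m)"
proof -
  define q where "q = (n - 1) div m"
  have mq: "m * q = n - 1"
    using m_dvd by (simp add: q_def)
  have "n > 1"
    using prime_n by (rule prime_gt_1_nat)
  then have "q > 0"
    using mq by (intro Nat.gr0I) auto
  have "coprime n g" "ord n g = m * q"
    using primroot prime_n by (simp_all add: residue_primroot_def totient_prime mq)
  then have "[g ^ (t * q) = g ^ (t' * q)] (mod n) \<longleftrightarrow> [t * q = t' * q] (mod m * q)"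
    using order_divides_expdiff by metis
  also have "\<dots> \<longleftrightarrow> [t = t'] (mod m)"
    using \<open>q > 0\<close> by (simp add: cong_def mod_mult_mult2)
  finally show ?thesis
    by (simp add: q_def)
qed

text \<open>Besides nonemptiness, this yields that an enumeration of the set by
  \<open>{1..m}\<close> has no repetitions.\<close>

lemma card_power_residue_set: "card (power_residue_set m n g) = m"
proof -
  have "inj_on (\<lambda>t. g ^ (t * ((n - 1) div m)) mod n) {..<m}"
  proof (rule inj_onI)
    fix t t' assume "t \<in> {..<m}" "t' \<in> {..<m}"
      "g ^ (t * ((n - 1) div m)) mod n = g ^ (t' * ((n - 1) div m)) mod n"
    then show "t = t'"
      using power_residue_exponent_cong[of t t']
      by (auto simp: cong_def)
  qed
  then show ?thesis
    by (simp add: power_residue_set_eq card_image)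
qed

lemma power_residue_set_less: "power_residue_set m n g \<subseteq> {..<n}"
  using prime_gt_0_nat[OF prime_n] by (auto simp: power_residue_set_eq)

lemma power_residue_set_coprime:
  assumes "h \<in> power_residue_set m n g"
  shows "coprime h n"
proof -
  have "coprime g n"
    using primroot by (simp add: residue_primroot_def coprime_commute)
  then show ?thesis
    using assms prime_gt_0_nat[OF prime_n] by (auto simp: power_residue_set_eq)
qed

lemma power_residue_set_closed:
  assumes "h \<in> power_residue_set m n g" "h' \<in> power_residue_set m n g"
  shows "h * h' mod n \<in> power_residue_set m n g"
proof -
  define q where "q = (n - 1) div m"
  obtain t t' where t: "h = g ^ (t * q) mod n" "h' = g ^ (t' * q) mod n"
    using assms by (auto simp: power_residue_set_eq q_def)
  have "h * h' mod n = g ^ ((t + t') * q) mod n"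
    by (simp add: t mod_simps power_add[symmetric] ring_distribs)
  \<comment> \<open>The sum \<open>t + t'\<close> may exceed \<open>m - 1\<close>, so it is brought
    back into the index range modulo \<open>m\<close>.\<close>
  also have "\<dots> = g ^ (((t + t') mod m) * q) mod n"
    using power_residue_exponent_cong[of "t + t'" "(t + t') mod m"]
    by (simp add: q_def cong_def)
  finally show ?thesis
    using m_pos by (auto simp: power_residue_set_eq q_def)
qed

lemma cmod_char_sum_power_residue_set_le:
  assumes "\<not> int n dvd l"
  shows "cmod (char_sum n (power_residue_set m n g) l) \<le> sqrt (real n)"
proof (rule cmod_char_sum_le)
  show "power_residue_set m n g \<noteq> {}"
    using card_power_residue_set m_pos by auto
  show "coprime l (int n)"
    using assms prime_n prime_imp_coprime[of "int n" l] by (simp add: coprime_commute)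
qed (simp_all add: power_residue_set_less power_residue_set_coprime power_residue_set_closed)

end

section \<open>Inner products of the real frame as character sums\<close>

definition frame_col :: "complex mat \<Rightarrow> nat \<Rightarrow> nat \<Rightarrow> complex" where
  "frame_col F i s =
     (if i < dim_col F then F $$ (s, i) else \<i> * F $$ (s, i - dim_col F))"

text \<open>Row \<open>s\<close> and row \<open>m + s\<close> together contribute Re z Re w + Im z
  Im w = Re (z * \<open>cnj\<close> w). The division by \<open>m\<close> comes from the two factors
  1 / sqrt m, which \<open>frame_col\<close> leaves out.\<close>

lemma real_frame_mat_inner:
  assumes F: "F \<in> carrier_mat m n" and "i < 2 * n" "j < 2 * n"
  shows "col (real_frame_mat m F) i \<bullet> col (real_frame_mat m F) j
    = Re (\<Sum>s<m. frame_col F i s * cnj (frame_col F j s)) / real m"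
proof -
  define V where "V = real_frame_mat m F"
  have dim: "dim_row V = m + m" "dim_col V = n + n"
    using real_frame_mat_carrier[OF F] by (auto simp: V_def)
  have V: "V $$ (s, c) = Re (frame_col F c s) / sqrt (real m)"
      "V $$ (m + s, c) = Im (frame_col F c s) / sqrt (real m)"
    if "s < m" "c < 2 * n" for s c
    using that F by (auto simp: V_def real_frame_mat_def frame_col_def)
  have "col V i \<bullet> col V j = (\<Sum>s<m + m. V $$ (s, i) * V $$ (s, j))"
    using assms by (simp add: scalar_prod_def dim atLeast0LessThan)
  also have "\<dots> = (\<Sum>s<m. V $$ (s, i) * V $$ (s, j))
      + (\<Sum>s<m. V $$ (m + s, i) * V $$ (m + s, j))"
    by (simp only: atLeast0LessThan[symmetric] sum.atLeastLessThan_concat[of 0 m "m + m", symmetric]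
        le_add1 zero_le sum.atLeastLessThan_shift_0[of _ m "m + m"] add_diff_cancel_left')
      (simp add: add.commute)
  also have "\<dots> = (\<Sum>s<m. Re (frame_col F i s * cnj (frame_col F j s)) / real m)"
    unfolding sum.distrib[symmetric] using assms
    by (intro sum.cong refl) (simp add: V add_divide_distrib[symmetric])
  finally show ?thesis
    by (simp add: V_def sum_divide_distrib)
qed

lemma partial_Fourier_mat_index:
  assumes "s < m" "j < n"
  shows "partial_Fourier_mat m n k $$ (s, j) = unit_char n (int (k (s + 1)) * int (j + 1))"
  using assms by (simp add: partial_Fourier_mat_def unit_char_def cis_conv_exp mult_ac)

lemma frame_col_partial_Fourier_mat:
  assumes "s < m" "i < 2 * n"
  shows "frame_col (partial_Fourier_mat m n k) i s
    = (if i < n then 1 else \<i>) * unit_char n (int (k (s + 1)) * int (i mod n + 1))"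
proof -
  have "dim_col (partial_Fourier_mat m n k) = n"
    by (simp add: partial_Fourier_mat_def)
  moreover have "i mod n = i - n" if "\<not> i < n"
    using that assms by (simp add: mod_if)
  ultimately show ?thesis
    using assms by (simp add: frame_col_def partial_Fourier_mat_index del: of_nat_add of_nat_Suc)
qed

text \<open>The 1-based shifts of the column numbers cancel in the difference of the two phases, and
  injectivity of \<open>k\<close> turns the sum over rows into a sum over the set of
  frequencies.\<close>

lemma frame_inner_eq_char_sum:
  assumes "inj_on k {1..m}" "i < 2 * n" "j < 2 * n"
  defines "V \<equiv> real_frame_mat m (partial_Fourier_mat m n k)"
  shows "col V i \<bullet> col V j
    = Re ((if i < n then 1 else \<i>) * cnj (if j < n then 1 else \<i>)
        * char_sum n (k ` {1..m}) (int (i mod n) - int (j mod n))) / real m"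
proof -
  define c :: "nat \<Rightarrow> complex" where "c i = (if i < n then 1 else \<i>)" for i
  define l where "l = int (i mod n) - int (j mod n)"
  have "(\<Sum>s<m. frame_col (partial_Fourier_mat m n k) i s * cnj (frame_col (partial_Fourier_mat m n k) j s))
      = (\<Sum>s<m. c i * cnj (c j) * unit_char n (int (k (s + 1)) * l))"
  proof (intro sum.cong refl)
    fix s assume "s \<in> {..<m}"
    have "int (k (s + 1)) * l = int (k (s + 1)) * int (i mod n + 1) - int (k (s + 1)) * int (j mod n + 1)"
      by (simp add: l_def algebra_simps)
    then show "frame_col (partial_Fourier_mat m n k) i s * cnj (frame_col (partial_Fourier_mat m n k) j s)
        = c i * cnj (c j) * unit_char n (int (k (s + 1)) * l)"
      using \<open>s \<in> {..<m}\<close> assms(2,3)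
      by (simp only: frame_col_partial_Fourier_mat unit_char_diff lessThan_iff c_def complex_cnj_mult mult_ac)
  qed
  also have "\<dots> = c i * cnj (c j) * (\<Sum>s<m. unit_char n (int (k (s + 1)) * l))"
    by (simp add: sum_distrib_left)
  also have "(\<Sum>s<m. unit_char n (int (k (s + 1)) * l)) = (\<Sum>s\<in>{1..m}. unit_char n (int (k s) * l))"
    by (rule sum.reindex_bij_witness[of _ "\<lambda>s. s - 1" Suc]) auto
  also have "\<dots> = char_sum n (k ` {1..m}) l"
    unfolding char_sum_def by (subst sum.reindex[OF assms(1)]) simp
  finally show ?thesis
    unfolding V_def c_def[symmetric] l_def[symmetric]
    by (simp only: real_frame_mat_inner[OF partial_Fourier_mat_carrier assms(2,3)])
qed

section \<open>Coherence bound: column pairs with equal and with distinct indices modulo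
  \<open>n\<close>\<close>

theorem theorem3:
  fixes m n g :: nat and k :: "nat \<Rightarrow> nat"
  assumes "m \<ge> 1"
    and "prime n"
    and "m dvd (n - 1)"
    and "residue_primroot n g"
    and "k ` {1..m} = power_residue_set m n g"
  shows "mutual_coherence (real_frame_mat m (partial_Fourier_mat m n k)) \<le> sqrt (real n) / real m"
proof -
  define V where "V = real_frame_mat m (partial_Fourier_mat m n k)"
  define H where "H = power_residue_set m n g"
  have "n > 0"
    using assms(2) by (rule prime_gt_0_nat)
  have dim: "dim_col V = 2 * n"
    using real_frame_mat_carrier[OF partial_Fourier_mat_carrier] by (auto simp: V_def)
  \<comment> \<open>\<open>k\<close> maps \<open>m\<close> indices onto a set of \<open>m\<close>
    elements.\<close>
  have inj: "inj_on k {1..m}"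
    using card_power_residue_set[OF assms(1-4)] assms(5) by (intro eq_card_imp_inj_on) auto
  have bound: "\<bar>col V i \<bullet> col V j\<bar> \<le> sqrt (real n) / real m"
    if ij: "i < 2 * n" "j < 2 * n" "i \<noteq> j" for i j
  proof -
    define u :: complex where "u = (if i < n then 1 else \<i>) * cnj (if j < n then 1 else \<i>)"
    define l where "l = int (i mod n) - int (j mod n)"
    have eq: "col V i \<bullet> col V j = Re (u * char_sum n H l) / real m"
      using frame_inner_eq_char_sum[OF inj ij(1,2)] assms(5) by (simp only: V_def u_def l_def H_def)
    have "\<bar>Re (u * char_sum n H l)\<bar> \<le> sqrt (real n)"
    proof (cases "i mod n = j mod n")
      case True
      \<comment> \<open>The columns are z and \<i> z for the same z: \<open>u\<close> is \<i> or
        -\<i> while the character sum is real, so the real part is 0.\<close>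
      then have "(i < n) \<noteq> (j < n)"
        using ij by (auto simp: mod_if split: if_splits)
      moreover have "char_sum n H l = of_nat (card H)"
        using True by (simp add: l_def char_sum_def)
      ultimately show ?thesis
        by (auto simp: u_def)
    next
      case False
      have "\<not> int n dvd l"
        using False by (simp add: l_def cong_iff_dvd_diff[symmetric] cong_int_iff) (simp add: cong_def)
      then have "cmod (char_sum n H l) \<le> sqrt (real n)"
        unfolding H_def by (rule cmod_char_sum_power_residue_set_le[OF assms(1-4)])
      moreover have "cmod u = 1"
        by (simp add: u_def norm_mult)
      ultimately show ?thesis
        using abs_Re_le_cmod[of "u * char_sum n H l"] by (simp add: norm_mult)
    qed
    then show ?thesis
      by (simp add: eq divide_right_mono)
  qed
  have "finite {\<bar>col V i \<bullet> col V j\<bar> | i j. i < dim_col V \<and> j < dim_col V \<and> i \<noteq> j}"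
    by (rule finite_subset[of _ "(\<lambda>(i, j). \<bar>col V i \<bullet> col V j\<bar>) ` ({..<dim_col V} \<times> {..<dim_col V})"])
      auto
  \<comment> \<open>Columns 0 and 1 exist because \<open>2 * n\<close> is at least 2, so
    \<open>Max\<close> is taken over a nonempty set.\<close>
  moreover have "0 < dim_col V \<and> 1 < dim_col V \<and> (0::nat) \<noteq> 1"
    using \<open>n > 0\<close> by (simp add: dim)
  then have "{\<bar>col V i \<bullet> col V j\<bar> | i j. i < dim_col V \<and> j < dim_col V \<and> i \<noteq> j} \<noteq> {}"
    by blast
  ultimately show ?thesis
    unfolding V_def[symmetric] mutual_coherence_def
    by (rule Max.boundedI) (auto simp: dim bound)
qed

end
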